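(* If $F\in\mathcal{H}^d$ is irreducible and $F(\mathcal{K}_{+,0})\subset\mathcal{K}_{+,0}$, then there exist $\boldsymbol{\lambda}\in\mathbb{R}^d_{++}$ and $\mathbf{u}\in\mathcal{S}_{++}$ such that $F(\mathbf{u})=\boldsymbol{\lambda}\otimes\mathbf{u}$.
   Context: Fix positive integers $d,n_1,\ldots,n_d$. Let $\mathcal{K}_+=\mathbb{R}^{n_1}_+\times\cdots\times\mathbb{R}^{n_d}_+$ (nonnegative entries), $\mathcal{K}_{+,0}=(\mathbb{R}^{n_1}_+\setminus\{0\})\times\cdots\times(\mathbb{R}^{n_d}_+\setminus\{0\})$, $\mathcal{K}_{++}=\mathbb{R}^{n_1}_{++}\times\cdots\times\mathbb{R}^{n_d}_{++}$ (positive entries). Write $\mathbf{x}=(\mathbf{x}_1,\ldots,\mathbf{x}_d)$ with $\mathbf{x}_i\in\mathbb{R}^{n_i}$. $\mathbf{x}\le\mathbf{y}$ means $\mathbf{y}-\mathbf{x}\in\mathcal{K}_+$. For $\boldsymbol{\alpha}\in\mathbb{R}^d$, $\boldsymbol{\alpha}\otimes\mathbf{x}=(\alpha_1\mathbf{x}_1,\ldots,\alpha_d\mathbf{x}_d)$. For $\boldsymbol{\alpha}\in\mathbb{R}^d_{++}$ and $B\in\mathbb{R}^{d\times d}$, $\boldsymbol{\alpha}^B=(\prod_{k}\alpha_k^{B_{1,k}},\ldots,\prod_k\alpha_k^{B_{d,k}})$. $\mathbf{1}$ is the vector of all ones. $F\colon\mathcal{K}_+\to\mathcal{K}_+$ is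 order-preserving if $\mathbf{x}\le\mathbf{y}$ implies $F(\mathbf{x})\le F(\mathbf{y})$; it is multi-homogeneous with homogeneity matrix $\mathcal{A}(F)=A\in\mathbb{R}^{d\times d}$ if $F(\boldsymbol{\alpha}\otimes\mathbf{x})=\boldsymbol{\alpha}^A\otimes F(\mathbf{x})$ for all $\mathbf{x}\in\mathcal{K}_+$, $\boldsymbol{\alpha}\in\mathbb{R}^d_{++}$. $\mathcal{H}^d$ is the set of $F\colon\mathcal{K}_+\to\mathcal{K}_+$ that are continuous, order-preserving and multi-homogeneous, with $F(\mathbf{1})\in\mathcal{K}_{++}$ and such that $\mathcal{A}(F)$ has at least one nonzero entry per row. A continuous, multi-homogeneous, order-preserving $F\colon\mathcal{K}_+\to\mathcal{K}_+$ is irreducible if for every $\mathbf{x}\in\mathcal{K}_{+,0}$ there exists a positive integer $m$ such that $H^m(\mathbf{x})\in\mathcal{K}_{++}$, where $H(\mathbf{x})=\mathbf{x}+F(\mathbf{x})$ and $H^m$ is the $m$-th iterate of $H$. For each $i$, $\|\cdot\|_{\gamma_i}$ is a norm on $\mathbb{R}^{n_i}$, assumed monotonic ($0\le\mathbf{x}_i\le\mathbf{y}_i$ implies $\|\mathbf{x}_i\|_{\gamma_i}\le\|\mathbf{y}_i\|_{\gamma_i}$), and $\mathcal{S}_{++}=\{\mathbf{x}\in\mathcal{K}_{++}:\|\mathbf{x}_i\|_{\gamma_i}=1,\ i=1,\ldots,d\}$. *)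

theory Defs
  imports "HOL-Analysis.Analysis"
begin

text \<open>
  Arbitrary positive integers \<open>d, n\<^sub>1, \<dots>, n\<^sub>d\<close> are encoded by a finite index type \<open>'d\<close> with
  \<open>CARD('d) = d\<close> and by nonempty sets \<open>N i\<close> of cardinality \<open>n\<^sub>i\<close> in a finite type \<open>'n\<close> (any type
  with at least \<open>max n\<^sub>i\<close> elements). The space \<open>\<real>\<close> to the power \<open>n\<^sub>i\<close> is the coordinate subspace of
  \<open>real ^ 'n\<close> of the vectors vanishing off \<open>N i\<close>, and a point \<open>x\<close> of the product space is an
  element of \<open>real ^ 'n ^ 'd\<close> whose \<open>i\<close>-th component vector is \<open>x $ i\<close>. The order on vectors is the
  entrywise order of the library.
\<close>

definition coord_space :: "'n set \<Rightarrow> (real ^ 'n::finite) set"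
  where "coord_space J = {v. \<forall>j. j \<notin> J \<longrightarrow> v $ j = 0}"

definition K_plus :: "('d \<Rightarrow> 'n set) \<Rightarrow> (real ^ 'n::finite ^ 'd::finite) set"
  where "K_plus N = {x. \<forall>i. x $ i \<in> coord_space (N i) \<and> 0 \<le> x $ i}"

definition K_plus_nz :: "('d \<Rightarrow> 'n set) \<Rightarrow> (real ^ 'n::finite ^ 'd::finite) set"
  where "K_plus_nz N = {x \<in> K_plus N. \<forall>i. x $ i \<noteq> 0}"

definition K_pos :: "('d \<Rightarrow> 'n set) \<Rightarrow> (real ^ 'n::finite ^ 'd::finite) set"
  where "K_pos N = {x. \<forall>i. x $ i \<in> coord_space (N i) \<and> (\<forall>j\<in>N i. 0 < x $ i $ j)}"

definition ones :: "('d \<Rightarrow> 'n set) \<Rightarrow> real ^ 'n::finite ^ 'd::finite"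
  where "ones N = (\<chi> i j. if j \<in> N i then 1 else 0)"

definition pos_vecs :: "(real ^ 'd::finite) set"
  where "pos_vecs = {\<alpha>. \<forall>i. 0 < \<alpha> $ i}"

definition block_scale :: "real ^ 'd::finite \<Rightarrow> real ^ 'n::finite ^ 'd \<Rightarrow> real ^ 'n ^ 'd"
  where "block_scale \<alpha> x = (\<chi> i. \<alpha> $ i *\<^sub>R x $ i)"

definition vec_mat_powr :: "real ^ 'd::finite \<Rightarrow> real ^ 'd ^ 'd \<Rightarrow> real ^ 'd"
  where "vec_mat_powr \<alpha> B = (\<chi> i. \<Prod>k\<in>UNIV. \<alpha> $ k powr B $ i $ k)"

text \<open>
  A map of \<open>K_plus N\<close> into itself is represented by a total function; only its values on
  \<open>K_plus N\<close> matter.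
\<close>

definition multi_homogeneous ::
  "('d \<Rightarrow> 'n set) \<Rightarrow> (real ^ 'n::finite ^ 'd::finite \<Rightarrow> real ^ 'n ^ 'd) \<Rightarrow> real ^ 'd ^ 'd \<Rightarrow> bool"
  where "multi_homogeneous N F A \<longleftrightarrow>
    (\<forall>x\<in>K_plus N. \<forall>\<alpha>\<in>pos_vecs.
      F (block_scale \<alpha> x) = block_scale (vec_mat_powr \<alpha> A) (F x))"

text \<open>
  The homogeneity matrix is existentially quantified here; by \<open>hom_matrix_unique\<close> below it is
  determined by \<open>F\<close>.
\<close>

definition H_class :: "('d \<Rightarrow> 'n set) \<Rightarrow> (real ^ 'n::finite ^ 'd::finite \<Rightarrow> real ^ 'n ^ 'd) set"
  where "H_class N = {F.
    F ` K_plus N \<subseteq> K_plus N \<and>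
    continuous_on (K_plus N) F \<and>
    mono_on (K_plus N) F \<and>
    F (ones N) \<in> K_pos N \<and>
    (\<exists>A. multi_homogeneous N F A \<and> (\<forall>i. \<exists>k. A $ i $ k \<noteq> 0))}"

definition irreducible_map ::
  "('d \<Rightarrow> 'n set) \<Rightarrow> (real ^ 'n::finite ^ 'd::finite \<Rightarrow> real ^ 'n ^ 'd) \<Rightarrow> bool"
  where "irreducible_map N F \<longleftrightarrow>
    (\<forall>x\<in>K_plus_nz N. \<exists>m::nat. 0 < m \<and> ((\<lambda>y. y + F y) ^^ m) x \<in> K_pos N)"

definition norm_on :: "(real ^ 'n::finite) set \<Rightarrow> (real ^ 'n \<Rightarrow> real) \<Rightarrow> bool"
  where "norm_on V g \<longleftrightarrow>
    (\<forall>v\<in>V. 0 \<le> g v \<and> (g v = 0 \<longleftrightarrow> v = 0)) \<and>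
    (\<forall>v\<in>V. \<forall>c. g (c *\<^sub>R v) = \<bar>c\<bar> * g v) \<and>
    (\<forall>v\<in>V. \<forall>w\<in>V. g (v + w) \<le> g v + g w)"

definition monotonic_norm_on :: "(real ^ 'n::finite) set \<Rightarrow> (real ^ 'n \<Rightarrow> real) \<Rightarrow> bool"
  where "monotonic_norm_on V g \<longleftrightarrow>
    norm_on V g \<and> (\<forall>v\<in>V. \<forall>w\<in>V. 0 \<le> v \<and> v \<le> w \<longrightarrow> g v \<le> g w)"

definition S_pos ::
  "('d \<Rightarrow> 'n set) \<Rightarrow> ('d \<Rightarrow> real ^ 'n \<Rightarrow> real) \<Rightarrow> (real ^ 'n::finite ^ 'd::finite) set"
  where "S_pos N \<gamma> = {x \<in> K_pos N. \<forall>i. \<gamma> i (x $ i) = 1}"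

lemma le_iff_diff_in_K_plus:
  assumes "\<forall>i. x $ i \<in> coord_space (N i)" and "\<forall>i. y $ i \<in> coord_space (N i)"
  shows "x \<le> y \<longleftrightarrow> y - x \<in> K_plus N"
  using assms by (auto simp: K_plus_def coord_space_def less_eq_vec_def)

lemma ones_in_K_plus: "ones N \<in> K_plus N"
  by (auto simp: ones_def K_plus_def coord_space_def less_eq_vec_def)

lemma hom_matrix_unique:
  fixes F :: "real ^ 'n::finite ^ 'd::finite \<Rightarrow> real ^ 'n ^ 'd"
  assumes ne: "\<And>i. N i \<noteq> {}" and pos: "F (ones N) \<in> K_pos N"
    and A: "multi_homogeneous N F A" and B: "multi_homogeneous N F B"
  shows "A = B"
proof -
  have "A $ i $ k = B $ i $ k" for i k
  proof -
    define \<alpha> :: "real ^ 'd" where "\<alpha> = (\<chi> l. if l = k then exp 1 else 1)"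
    have \<alpha>: "\<alpha> \<in> pos_vecs" by (auto simp: \<alpha>_def pos_vecs_def)
    have pw: "vec_mat_powr \<alpha> C $ i = exp (C $ i $ k)" for C
    proof -
      have "vec_mat_powr \<alpha> C $ i = (\<Prod>l\<in>UNIV. if l = k then exp (C $ i $ k) else 1)"
        unfolding vec_mat_powr_def vec_lambda_beta by (rule prod.cong) (auto simp: \<alpha>_def powr_def)
      then show ?thesis by simp
    qed
    obtain j where j: "j \<in> N i" using ne by blast
    have "block_scale (vec_mat_powr \<alpha> A) (F (ones N)) = block_scale (vec_mat_powr \<alpha> B) (F (ones N))"
      using A B \<alpha> ones_in_K_plus unfolding multi_homogeneous_def by metis
    then have "block_scale (vec_mat_powr \<alpha> A) (F (ones N)) $ i $ j
        = block_scale (vec_mat_powr \<alpha> B) (F (ones N)) $ i $ j" by simp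
    moreover have "0 < F (ones N) $ i $ j" using pos j by (simp add: K_pos_def)
    ultimately show ?thesis by (simp add: block_scale_def pw)
  qed
  then show ?thesis by (simp add: vec_eq_iff)
qed

end

theory Submission
  imports Defs
begin

text \<open>
  Multi-homogeneity makes the choice of the norms immaterial: if \<open>F v = lam \<otimes> v\<close>, then every
  rescaling \<open>\<alpha> \<otimes> v\<close> with \<open>\<alpha> > 0\<close> also satisfies an equation of this form, with another positive
  factor. So the blocks may first be normalized by the sum of their entries, which is linear on
  the cone, and the normalized points form a product of simplices: a compact convex set, whatever
  the shape of the spheres of the given norms. Since \<open>F\<close> maps no point with nonzero blocks to a
  point with a zero block, the values of \<open>F\<close> on this product can be normalized again, and Brouwer's
  theorem gives a point \<open>v\<close> there with \<open>F v = lam \<otimes> v\<close>, \<open>lam > 0\<close> (\<open>block_eigenvector_exists\<close>).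

  So far \<open>v\<close> may have zero entries. But the positive rescalings of \<open>v\<close> are stable under
  \<open>H = id + F\<close>, so every iterate of \<open>H\<close> at \<open>v\<close> has exactly the zero entries of \<open>v\<close>, while
  irreducibility makes one of these iterates positive (\<open>irreducible_block_eigenvector_positive\<close>).
  A last rescaling of \<open>v\<close> gives its blocks the norm one.
\<close>

lemma vec_mat_powr_pos: "\<alpha> \<in> pos_vecs \<Longrightarrow> vec_mat_powr \<alpha> B \<in> pos_vecs"
  by (auto simp: pos_vecs_def vec_mat_powr_def less_imp_neq[symmetric] intro!: prod_pos)

lemma block_scale_K_plus: "\<alpha> \<in> pos_vecs \<Longrightarrow> x \<in> K_plus N \<Longrightarrow> block_scale \<alpha> x \<in> K_plus N"
  by (auto simp: pos_vecs_def K_plus_def block_scale_def coord_space_def less_eq_vec_def less_imp_le)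

lemma block_scale_K_pos_iff:
  assumes "\<alpha> \<in> pos_vecs"
  shows "block_scale \<alpha> x \<in> K_pos N \<longleftrightarrow> x \<in> K_pos N"
proof -
  have "\<alpha> $ i \<noteq> 0" "0 < \<alpha> $ i * c \<longleftrightarrow> 0 < c" for i c
    using assms by (simp_all add: pos_vecs_def zero_less_mult_iff less_imp_neq[symmetric]
        order_less_not_sym)
  then show ?thesis
    by (simp add: K_pos_def block_scale_def coord_space_def)
qed

lemma block_scale_block_scale:
  "block_scale \<alpha> (block_scale \<beta> x) = block_scale (\<chi> i. \<alpha> $ i * \<beta> $ i) x"
  by (simp add: block_scale_def)

lemma block_scale_add: "block_scale \<alpha> x + block_scale \<beta> x = block_scale (\<alpha> + \<beta>) x"
  by (simp add: block_scale_def vec_eq_iff algebra_simps)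

lemma block_eigenvector_rescale:
  assumes hom: "multi_homogeneous N F A" and v: "v \<in> K_plus N"
    and lam: "lam \<in> pos_vecs" and eig: "F v = block_scale lam v" and \<alpha>: "\<alpha> \<in> pos_vecs"
  obtains \<mu> where "\<mu> \<in> pos_vecs" "F (block_scale \<alpha> v) = block_scale \<mu> (block_scale \<alpha> v)"
proof
  let ?\<mu> = "\<chi> i. vec_mat_powr \<alpha> A $ i * lam $ i / \<alpha> $ i"
  show "?\<mu> \<in> pos_vecs"
    using vec_mat_powr_pos[OF \<alpha>, of A] lam \<alpha> by (simp add: pos_vecs_def)
  have "F (block_scale \<alpha> v) = block_scale (vec_mat_powr \<alpha> A) (block_scale lam v)"
    using hom v \<alpha> eig by (simp add: multi_homogeneous_def)
  also have "\<dots> = block_scale ?\<mu> (block_scale \<alpha> v)"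
    using \<alpha> by (simp add: block_scale_block_scale pos_vecs_def less_imp_neq[symmetric])
  finally show "F (block_scale \<alpha> v) = block_scale ?\<mu> (block_scale \<alpha> v)" .
qed

text \<open>
  The iterates of \<open>id + F\<close> at a block eigenvector stay on its orbit under positive rescalings, so
  they never acquire a positive entry that the eigenvector lacks.
\<close>

lemma irreducible_block_eigenvector_positive:
  assumes irr: "irreducible_map N F" and hom: "multi_homogeneous N F A"
    and v: "v \<in> K_plus_nz N" and lam: "lam \<in> pos_vecs" and eig: "F v = block_scale lam v"
  shows "v \<in> K_pos N"
proof -
  have vK: "v \<in> K_plus N"
    using v by (simp add: K_plus_nz_def)
  have orbit: "\<exists>\<beta>\<in>pos_vecs. ((\<lambda>y. y + F y) ^^ m) v = block_scale \<beta> v" for m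
  proof (induction m)
    case 0
    have "(\<chi> i. 1) \<in> pos_vecs" "v = block_scale (\<chi> i. 1) v"
      by (simp_all add: pos_vecs_def block_scale_def)
    then show ?case by auto
  next
    case (Suc m)
    then obtain \<beta> where \<beta>: "\<beta> \<in> pos_vecs" "((\<lambda>y. y + F y) ^^ m) v = block_scale \<beta> v"
      by blast
    obtain \<mu> where \<mu>: "\<mu> \<in> pos_vecs" "F (block_scale \<beta> v) = block_scale \<mu> (block_scale \<beta> v)"
      using block_eigenvector_rescale[OF hom vK lam eig \<beta>(1)] by blast
    have "((\<lambda>y. y + F y) ^^ Suc m) v = block_scale (\<beta> + (\<chi> i. \<mu> $ i * \<beta> $ i)) v"
      by (simp add: \<beta> \<mu> block_scale_block_scale block_scale_add)
    moreover have "\<beta> + (\<chi> i. \<mu> $ i * \<beta> $ i) \<in> pos_vecs"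
      using \<beta>(1) \<mu>(1) by (simp add: pos_vecs_def add_pos_pos)
    ultimately show ?case by blast
  qed
  obtain m where "((\<lambda>y. y + F y) ^^ m) v \<in> K_pos N"
    using irr v unfolding irreducible_map_def by blast
  then show ?thesis
    using orbit[of m] block_scale_K_pos_iff by metis
qed

definition simplex_product :: "('d \<Rightarrow> 'n set) \<Rightarrow> (real ^ 'n::finite ^ 'd::finite) set"
  where "simplex_product N = {x \<in> K_plus N. \<forall>i. (\<Sum>j\<in>UNIV. x $ i $ j) = 1}"

definition inverse_block_sums :: "real ^ 'n::finite ^ 'd::finite \<Rightarrow> real ^ 'd"
  where "inverse_block_sums x = (\<chi> i. inverse (\<Sum>j\<in>UNIV. x $ i $ j))"

lemma block_sum_pos:
  assumes "x \<in> K_plus_nz N"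
  shows "0 < (\<Sum>j\<in>UNIV. x $ i $ j)"
proof -
  have nn: "\<forall>j. 0 \<le> x $ i $ j"
    using assms by (auto simp: K_plus_nz_def K_plus_def less_eq_vec_def)
  obtain j where "x $ i $ j \<noteq> 0"
    using assms by (auto simp: K_plus_nz_def vec_eq_iff)
  then show ?thesis
    using nn by (intro sum_pos2[of _ j]) (auto simp: less_le)
qed

lemma inverse_block_sums_pos: "x \<in> K_plus_nz N \<Longrightarrow> inverse_block_sums x \<in> pos_vecs"
  using block_sum_pos by (auto simp: pos_vecs_def inverse_block_sums_def)

lemma normalize_in_simplex_product:
  assumes x: "x \<in> K_plus_nz N"
  shows "block_scale (inverse_block_sums x) x \<in> simplex_product N"
proof -
  have "block_scale (inverse_block_sums x) x \<in> K_plus N"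
    using x by (intro block_scale_K_plus inverse_block_sums_pos) (auto simp: K_plus_nz_def)
  then show ?thesis
    using block_sum_pos[OF x]
    by (simp add: simplex_product_def block_scale_def inverse_block_sums_def
        less_imp_neq[symmetric] flip: sum_distrib_left)
qed

lemma simplex_product_subset: "simplex_product N \<subseteq> K_plus_nz N"
proof
  fix x assume x: "x \<in> simplex_product N"
  have "x $ i \<noteq> 0" for i
  proof
    assume "x $ i = 0"
    then have "(\<Sum>j\<in>UNIV. x $ i $ j) = 0" by simp
    with x show False by (simp add: simplex_product_def)
  qed
  with x show "x \<in> K_plus_nz N" by (simp add: simplex_product_def K_plus_nz_def)
qed

lemma simplex_product_nonempty:
  assumes "\<forall>i. N i \<noteq> {}"
  shows "simplex_product N \<noteq> {}"
proof -
  have "ones N $ i \<noteq> 0" for i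
    using assms by (auto simp: ones_def vec_eq_iff)
  then have "ones N \<in> K_plus_nz N"
    by (simp add: K_plus_nz_def ones_in_K_plus)
  then show ?thesis
    using normalize_in_simplex_product by blast
qed

lemma convex_simplex_product: "convex (simplex_product N)"
  by (auto simp: convex_def simplex_product_def K_plus_def coord_space_def less_eq_vec_def
      sum.distrib simp flip: sum_distrib_left)

lemma compact_simplex_product: "compact (simplex_product N)"
proof -
  have "norm x \<le> real CARD('b)" if x: "x \<in> simplex_product N" for x :: "real ^ 'a ^ 'b"
  proof -
    have "norm (x $ i) \<le> 1" for i
    proof -
      have "norm (x $ i) \<le> (\<Sum>j\<in>UNIV. \<bar>x $ i $ j\<bar>)"
        by (rule norm_le_l1_cart)
      also have "\<dots> = (\<Sum>j\<in>UNIV. x $ i $ j)"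
        using x by (auto simp: simplex_product_def K_plus_def less_eq_vec_def)
      finally show ?thesis
        using x by (simp add: simplex_product_def)
    qed
    then have "(\<Sum>i\<in>UNIV. norm (x $ i)) \<le> real CARD('b)"
      using sum_bounded_above[of UNIV "\<lambda>i. norm (x $ i)" 1] by simp
    moreover have "norm x \<le> (\<Sum>i\<in>UNIV. norm (x $ i))"
      unfolding norm_vec_def by (rule L2_set_le_sum) simp
    ultimately show ?thesis by simp
  qed
  then have "bounded (simplex_product N)"
    by (auto simp: bounded_iff)
  moreover have "closed (simplex_product N)"
    unfolding simplex_product_def K_plus_def coord_space_def less_eq_vec_def mem_Collect_eq
    by (intro closed_Collect_conj closed_Collect_all closed_Collect_imp closed_Collect_eq
        closed_Collect_le open_Collect_const continuous_intros)
  ultimately show ?thesis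
    by (simp add: compact_eq_bounded_closed)
qed

text \<open>A fixed point of the normalized map is a block eigenvector, and Brouwer's theorem applies.\<close>

lemma block_eigenvector_exists:
  fixes F :: "real ^ 'n::finite ^ 'd::finite \<Rightarrow> real ^ 'n ^ 'd"
  assumes ne: "\<forall>i. N i \<noteq> {}" and cont: "continuous_on (K_plus_nz N) F"
    and nz: "F ` K_plus_nz N \<subseteq> K_plus_nz N"
  obtains lam v where "lam \<in> pos_vecs" "v \<in> K_plus_nz N" "F v = block_scale lam v"
proof -
  define G where "G x = block_scale (inverse_block_sums (F x)) (F x)" for x
  let ?S = "simplex_product N"
  have Fnz: "F x \<in> K_plus_nz N" if "x \<in> ?S" for x
    using that nz simplex_product_subset by blast
  have contF: "continuous_on ?S F"
    using cont simplex_product_subset by (rule continuous_on_subset)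
  have "continuous_on ?S G"
    unfolding G_def block_scale_def inverse_block_sums_def
    by (intro continuous_intros contF) (use block_sum_pos[OF Fnz] in \<open>simp add: less_imp_neq[symmetric]\<close>)
  moreover have "G \<in> ?S \<rightarrow> ?S"
    unfolding G_def by (intro funcsetI normalize_in_simplex_product Fnz)
  ultimately obtain v where v: "v \<in> ?S" "G v = v"
    using brouwer[OF compact_simplex_product convex_simplex_product simplex_product_nonempty[OF ne]]
    by metis
  show thesis
  proof
    show "v \<in> K_plus_nz N"
      using v(1) simplex_product_subset by blast
    let ?lam = "\<chi> i. \<Sum>j\<in>UNIV. F v $ i $ j"
    show "?lam \<in> pos_vecs"
      using block_sum_pos[OF Fnz[OF v(1)]] by (simp add: pos_vecs_def)
    have "block_scale ?lam (G v) = F v"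
      using block_sum_pos[OF Fnz[OF v(1)]]
      by (simp add: G_def block_scale_block_scale)
        (simp add: block_scale_def inverse_block_sums_def less_imp_neq[symmetric])
    then show "F v = block_scale ?lam v"
      by (simp add: v(2))
  qed
qed

theorem theorem3p2:
  fixes N :: "'d::finite \<Rightarrow> 'n::finite set"
    and \<gamma> :: "'d \<Rightarrow> real ^ 'n \<Rightarrow> real"
    and F :: "real ^ 'n ^ 'd \<Rightarrow> real ^ 'n ^ 'd"
  assumes "\<forall>i. N i \<noteq> {}"
    and "\<forall>i. monotonic_norm_on (coord_space (N i)) (\<gamma> i)"
    and "F \<in> H_class N"
    and "irreducible_map N F"
    and "F ` K_plus_nz N \<subseteq> K_plus_nz N"
  shows "\<exists>lam\<in>pos_vecs. \<exists>u\<in>S_pos N \<gamma>. F u = block_scale lam u"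
proof -
  obtain A where hom: "multi_homogeneous N F A"
    using assms(3) by (auto simp: H_class_def)
  have "continuous_on (K_plus_nz N) F"
    using assms(3) by (auto simp: H_class_def K_plus_nz_def intro: continuous_on_subset)
  then obtain lam v where lam: "lam \<in> pos_vecs" and v: "v \<in> K_plus_nz N"
    and eig: "F v = block_scale lam v"
    using block_eigenvector_exists[OF assms(1) _ assms(5)] by blast
  have vpos: "v \<in> K_pos N"
    using irreducible_block_eigenvector_positive[OF assms(4) hom v lam eig] .
  have vK: "v \<in> K_plus N" and vnz: "v $ i \<noteq> 0" and vi: "v $ i \<in> coord_space (N i)" for i
    using v by (simp_all add: K_plus_nz_def K_plus_def)
  have norm: "norm_on (coord_space (N i)) (\<gamma> i)" for i
    using assms(2) by (simp add: monotonic_norm_on_def)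
  have \<gamma>pos: "0 < \<gamma> i (v $ i)" for i
    using norm[of i] vi[of i] vnz[of i] by (simp add: norm_on_def less_le)
  define \<alpha> :: "real ^ 'd" where "\<alpha> = (\<chi> i. inverse (\<gamma> i (v $ i)))"
  have \<alpha>: "\<alpha> \<in> pos_vecs"
    using \<gamma>pos by (simp add: \<alpha>_def pos_vecs_def)
  have "\<gamma> i (block_scale \<alpha> v $ i) = \<bar>\<alpha> $ i\<bar> * \<gamma> i (v $ i)" for i
    using norm[of i] vi[of i] by (simp add: norm_on_def block_scale_def)
  then have "\<gamma> i (block_scale \<alpha> v $ i) = 1" for i
    using \<gamma>pos[of i] by (simp add: \<alpha>_def)
  then have "block_scale \<alpha> v \<in> S_pos N \<gamma>"
    using \<alpha> vpos by (simp add: S_pos_def block_scale_K_pos_iff)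
  then show ?thesis
    using block_eigenvector_rescale[OF hom vK lam eig \<alpha>] by blast
qed

end
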